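(* For each $n$, let $m'_n$ be the number of matroids with ground set $[n]=\{1,\dots,n\}$ that do not have a minor isomorphic to $M(K_4)$. Then $$\log_2 m'_n \ge \frac{1}{n}\binom{n}{\lfloor n/2\rfloor}(1-o(1)) \qquad \text{as } n\to\infty.$$
   Context: $M(K_4)$ is the cycle matroid of the complete graph on 4 vertices (a rank-3 matroid on 6 elements). *)

theory Defs
  imports Complex_Main "HOL-Library.Landau_Symbols"
begin

record 'a matroid =
  ground :: "'a set"
  indeps :: "'a set set"

definition is_matroid :: "'a matroid \<Rightarrow> bool" where
  "is_matroid M \<longleftrightarrow>
     finite (ground M) \<and>
     indeps M \<subseteq> Pow (ground M) \<and>
     {} \<in> indeps M \<and>
     (\<forall>I\<in>indeps M. \<forall>J. J \<subseteq> I \<longrightarrow> J \<in> indeps M) \<and>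
     (\<forall>I\<in>indeps M. \<forall>J\<in>indeps M. card I < card J \<longrightarrow> (\<exists>x\<in>J - I. insert x I \<in> indeps M))"

definition basis_in :: "'a matroid \<Rightarrow> 'a set \<Rightarrow> 'a set \<Rightarrow> bool" where
  "basis_in M X B \<longleftrightarrow>
     B \<in> indeps M \<and> B \<subseteq> X \<and> (\<forall>B'\<in>indeps M. B \<subseteq> B' \<and> B' \<subseteq> X \<longrightarrow> B' = B)"

definition deletion :: "'a matroid \<Rightarrow> 'a set \<Rightarrow> 'a matroid" where
  "deletion M D = \<lparr>ground = ground M - D, indeps = {I \<in> indeps M. I \<subseteq> ground M - D}\<rparr>"

text \<open>In a matroid the choice of the basis \<open>B\<close> of \<open>C\<close> does not matter.\<close>

definition contraction :: "'a matroid \<Rightarrow> 'a set \<Rightarrow> 'a matroid" where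
  "contraction M C =
     \<lparr>ground = ground M - C,
      indeps = {I. I \<subseteq> ground M - C \<and> (\<exists>B. basis_in M C B \<and> I \<union> B \<in> indeps M)}\<rparr>"

definition is_minor :: "'a matroid \<Rightarrow> 'a matroid \<Rightarrow> bool" where
  "is_minor N M \<longleftrightarrow>
     (\<exists>C D. C \<subseteq> ground M \<and> D \<subseteq> ground M \<and> C \<inter> D = {} \<and> N = deletion (contraction M C) D)"

definition matroid_iso :: "'a matroid \<Rightarrow> 'b matroid \<Rightarrow> bool" where
  "matroid_iso M N \<longleftrightarrow>
     (\<exists>f. bij_betw f (ground M) (ground N) \<and>
          (\<forall>I. I \<subseteq> ground M \<longrightarrow> (I \<in> indeps M \<longleftrightarrow> f ` I \<in> indeps N)))"

definition has_minor_iso :: "'a matroid \<Rightarrow> 'b matroid \<Rightarrow> bool" where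
  "has_minor_iso M N \<longleftrightarrow> (\<exists>N'. is_minor N' M \<and> matroid_iso N' N)"

text \<open>
  A simple graph is given by its set of edges, each edge being a two-element set of vertices.
  A cycle is given by the list of its vertices in cyclic order.
\<close>

definition complete_graph :: "'v set \<Rightarrow> 'v set set" where
  "complete_graph V = {e. e \<subseteq> V \<and> card e = 2}"

definition cycle_edges :: "'v list \<Rightarrow> 'v set set" where
  "cycle_edges vs = {{vs ! i, vs ! (Suc i mod length vs)} | i. i < length vs}"

definition is_forest :: "'v set set \<Rightarrow> bool" where
  "is_forest F \<longleftrightarrow> \<not> (\<exists>vs. 3 \<le> length vs \<and> distinct vs \<and> cycle_edges vs \<subseteq> F)"

definition cycle_matroid :: "'v set set \<Rightarrow> 'v set matroid" where
  "cycle_matroid G = \<lparr>ground = G, indeps = {F. F \<subseteq> G \<and> is_forest F}\<rparr>"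

definition MK4 :: "nat set matroid" where
  "MK4 = cycle_matroid (complete_graph {1..4})"

definition matroids_without_MK4 :: "nat \<Rightarrow> nat matroid set" where
  "matroids_without_MK4 n =
     {M. is_matroid M \<and> ground M = {1..n} \<and> \<not> has_minor_iso M MK4}"

lemma finite_matroids_without_MK4: "finite (matroids_without_MK4 n)"
proof (rule finite_subset)
  show "matroids_without_MK4 n \<subseteq>
    (\<lambda>S. \<lparr>ground = {1..n}, indeps = S\<rparr>) ` Pow (Pow {1..n})"
  proof
    fix M assume "M \<in> matroids_without_MK4 n"
    then have "ground M = {1..n}" "indeps M \<in> Pow (Pow {1..n})"
      unfolding matroids_without_MK4_def is_matroid_def by (metis (mono_tags, lifting) CollectD, metis (mono_tags, lifting) CollectD PowI)
    then show "M \<in> (\<lambda>S. \<lparr>ground = {1..n}, indeps = S\<rparr>) ` Pow (Pow {1..n})"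
      by (intro image_eqI[of _ _ "indeps M"]) simp_all
  qed
qed simp

definition m' :: "nat \<Rightarrow> nat" where
  "m' n = card (matroids_without_MK4 n)"

end

theory Submission
  imports Defs "HOL-Number_Theory.Cong"
begin

text \<open>
  Let \<open>r = \<lfloor>n/2\<rfloor>\<close> and let \<open>q \<in> {n, n+1}\<close> be odd. Following Graham and Sloane, sort the \<open>r\<close>-subsets
  of \<open>{1..n}\<close> by the residue modulo \<open>q\<close> of the sum of their elements; some class has at least
  \<open>(n choose r) / q\<close> members. Two \<open>r\<close>-sets of one class never differ in a single exchange, so every
  subfamily of the class is the set of circuit-hyperplanes of a sparse paving matroid.
  A minor \<open>M(K\<^sub>4)\<close> would give four circuit-hyperplanes \<open>B \<union> T\<close>, where \<open>T\<close> runs through the triangles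
  \<open>{a,b,c}\<close>, \<open>{a,b',c'}\<close>, \<open>{a',b,c'}\<close>, \<open>{a',b',c}\<close>. Adding the first two sums and subtracting the
  last two yields \<open>2(a - a') \<equiv> 0\<close> modulo \<open>q\<close>, which is impossible since \<open>q\<close> is odd.
\<close>

section \<open>Sparse paving matroids and the pull-back of minors\<close>

definition sparse_paving :: "'a set \<Rightarrow> nat \<Rightarrow> 'a set set \<Rightarrow> 'a matroid" where
  "sparse_paving E r H = \<lparr>ground = E, indeps = {I. I \<subseteq> E \<and> card I \<le> r \<and> I \<notin> H}\<rparr>"

text \<open>By \<open>sep\<close>, for an independent set of size \<open>r - 1\<close> at most one
  added element can lead into \<open>H\<close>. If the first candidate from \<open>J - I\<close> is
  blocked, \<open>J\<close> offers a second one. Positivity of \<open>r\<close> keeps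
  \<open>{}\<close> out of \<open>H\<close>.\<close>

lemma is_matroid_sparse_paving:
  assumes E: "finite E" and r: "0 < r"
    and H: "\<And>X. X \<in> H \<Longrightarrow> card X = r"
    and sep: "\<And>I x y. insert x I \<in> H \<Longrightarrow> insert y I \<in> H \<Longrightarrow> x \<notin> I \<Longrightarrow> y \<notin> I \<Longrightarrow> x = y"
  shows "is_matroid (sparse_paving E r H)"
proof -
  have down: "J \<subseteq> E \<and> card J \<le> r \<and> J \<notin> H"
    if "I \<subseteq> E" "card I \<le> r" "I \<notin> H" "J \<subseteq> I" for I J
  proof -
    have "finite I" using E that(1) finite_subset by blast
    then have "card J \<le> card I" using that(4) by (rule card_mono)
    moreover have "J \<notin> H"
    proof
      assume "J \<in> H"
      then have "card J = card I" using H that(2) \<open>card J \<le> card I\<close> by fastforce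
      then have "J = I" using \<open>finite I\<close> that(4) by (intro card_subset_eq)
      then show False using \<open>J \<in> H\<close> that(3) by simp
    qed
    ultimately show ?thesis using that by auto
  qed
  have exch: "\<exists>x\<in>J - I. insert x I \<subseteq> E \<and> card (insert x I) \<le> r \<and> insert x I \<notin> H"
    if I: "I \<subseteq> E" and J: "J \<subseteq> E" "card J \<le> r" "J \<notin> H" and less: "card I < card J" for I J
  proof -
    have fin: "finite I" "finite J"
      using E I J(1) finite_subset by blast+
    obtain x where x: "x \<in> J" "x \<notin> I"
      using fin less card_mono[of I J] by fastforce
    have card_insert: "card (insert y I) = Suc (card I)" if "y \<notin> I" for y
      using fin that by simp
    show ?thesis
    proof (cases "insert x I \<in> H")
      case False
      then show ?thesis using x I J less card_insert[of x] by auto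
    next
      case True
      \<comment> \<open>Both sizes are \<open>r\<close>. As \<open>J\<close> is not in
        \<open>H\<close>, it differs from \<open>insert x I\<close> and so has another element
        outside \<open>I\<close>.\<close>
      then have "card (insert x I) = card J"
        using H[OF True] card_insert[OF x(2)] J(2) less by linarith
      moreover have "insert x I \<noteq> J" using True J(3) by blast
      ultimately have "\<not> J \<subseteq> insert x I"
        using card_subset_eq[of "insert x I" J] fin by auto
      then obtain y where y: "y \<in> J" "y \<notin> I" "y \<noteq> x" by blast
      then have "insert y I \<notin> H" using sep True x(2) by blast
      then show ?thesis using y I J less card_insert[of y] by auto
    qed
  qed
  have "{} \<notin> H" using H r by fastforce
  then have "{} \<in> indeps (sparse_paving E r H)" by (simp add: sparse_paving_def)
  moreover have "J \<in> indeps (sparse_paving E r H)"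
    if "I \<in> indeps (sparse_paving E r H)" "J \<subseteq> I" for I J
    using down[of I J] that by (simp add: sparse_paving_def)
  moreover have "\<exists>x\<in>J - I. insert x I \<in> indeps (sparse_paving E r H)"
    if "I \<in> indeps (sparse_paving E r H)" "J \<in> indeps (sparse_paving E r H)" "card I < card J"
    for I J
    using exch[of I J] that by (simp add: sparse_paving_def)
  moreover have "finite (ground (sparse_paving E r H))"
    "indeps (sparse_paving E r H) \<subseteq> Pow (ground (sparse_paving E r H))"
    using E by (auto simp: sparse_paving_def)
  ultimately show ?thesis
    unfolding is_matroid_def by blast
qed

text \<open>Independence in a contraction is existential over bases of the contracted set, so
  dependence holds for every basis. The independent set \<open>F0\<close> supplies one basis
  \<open>B\<close>, and this same \<open>B\<close> then serves all dependent \<open>F\<close>,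
  without any comparison of bases. \<open>g\<close> is the inverse of the isomorphism.\<close>

lemma has_minor_isoE:
  assumes "has_minor_iso M N" and F0: "F0 \<in> indeps N" "F0 \<subseteq> ground N"
  obtains g B where "inj_on g (ground N)" "g ` ground N \<subseteq> ground M"
    "B \<subseteq> ground M" "B \<inter> g ` ground N = {}" "g ` F0 \<union> B \<in> indeps M"
    "\<And>F. F \<subseteq> ground N \<Longrightarrow> F \<notin> indeps N \<Longrightarrow> g ` F \<union> B \<notin> indeps M"
proof -
  obtain C D f where CD: "C \<subseteq> ground M"
    and f: "bij_betw f (ground M - C - D) (ground N)"
    and ind: "\<And>I. I \<subseteq> ground M - C - D \<Longrightarrow>
      (\<exists>B. basis_in M C B \<and> I \<union> B \<in> indeps M) \<longleftrightarrow> f ` I \<in> indeps N"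
  proof -
    from assms(1) obtain C D f where C: "C \<subseteq> ground M"
      and N': "bij_betw f (ground (deletion (contraction M C) D)) (ground N)"
      "\<And>I. I \<subseteq> ground (deletion (contraction M C) D) \<Longrightarrow>
        I \<in> indeps (deletion (contraction M C) D) \<longleftrightarrow> f ` I \<in> indeps N"
      unfolding has_minor_iso_def is_minor_def matroid_iso_def by blast
    have bij: "bij_betw f (ground M - C - D) (ground N)"
      using N'(1) by (simp add: contraction_def deletion_def)
    have "(\<exists>B. basis_in M C B \<and> I \<union> B \<in> indeps M) \<longleftrightarrow> f ` I \<in> indeps N"
      if "I \<subseteq> ground M - C - D" for I
      using N'(2)[of I] that by (auto simp: contraction_def deletion_def)
    then show thesis by (rule that[OF C bij])
  qed
  define g where "g = inv_into (ground M - C - D) f"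
  have g: "bij_betw g (ground N) (ground M - C - D)"
    unfolding g_def by (rule bij_betw_inv_into[OF f])
  have img: "g ` F \<subseteq> ground M - C - D" if "F \<subseteq> ground N" for F
    using g that by (auto simp: bij_betw_def)
  have fg: "f ` g ` F = F" if "F \<subseteq> ground N" for F
    unfolding g_def using f that by (simp add: bij_betw_def image_inv_into_cancel)
  obtain B where B: "basis_in M C B" "g ` F0 \<union> B \<in> indeps M"
    using ind[OF img[OF F0(2)]] fg[OF F0(2)] F0(1) by auto
  have "B \<subseteq> C" using B(1) by (simp add: basis_in_def)
  show thesis
  proof
    show "inj_on g (ground N)" using g by (simp add: bij_betw_def)
    show "g ` ground N \<subseteq> ground M" "B \<subseteq> ground M" "B \<inter> g ` ground N = {}"
      using \<open>B \<subseteq> C\<close> CD img[OF subset_refl] by auto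
    show "g ` F0 \<union> B \<in> indeps M" by (rule B(2))
    show "g ` F \<union> B \<notin> indeps M" if "F \<subseteq> ground N" "F \<notin> indeps N" for F
      using ind[OF img[OF that(1)]] fg[OF that(1)] that(2) B(1) by auto
  qed
qed

section \<open>Stars and triangles in the cycle matroid of K4\<close>

lemma triangle_not_forest:
  assumes "distinct [u, v, w]"
  shows "\<not> is_forest {{u, v}, {v, w}, {w, u}}"
proof -
  have "cycle_edges [u, v, w] \<subseteq> {{u, v}, {v, w}, {w, u}}"
    by (auto simp: cycle_edges_def less_Suc_eq)
  then show ?thesis
    unfolding is_forest_def using assms
    by (metis One_nat_def Suc_1 length_Cons list.size(3) numeral_3_eq_3 order_refl)
qed

text \<open>On a cycle, two consecutive edges share only their middle vertex, so \<open>z\<close>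
  would have to be \<open>vs ! 1\<close>; the third edge misses that vertex.\<close>

lemma star_is_forest:
  assumes star: "\<And>e. e \<in> F \<Longrightarrow> z \<in> e"
  shows "is_forest F"
  unfolding is_forest_def
proof
  assume "\<exists>vs. 3 \<le> length vs \<and> distinct vs \<and> cycle_edges vs \<subseteq> F"
  then obtain vs where len: "3 \<le> length vs" and d: "distinct vs"
    and sub: "cycle_edges vs \<subseteq> F" by blast
  have edge: "z \<in> {vs ! i, vs ! (Suc i mod length vs)}" if "i < length vs" for i
    using star sub that by (auto simp: cycle_edges_def)
  have "z \<in> {vs ! 0, vs ! 1}" "z \<in> {vs ! 1, vs ! 2}"
    using edge[of 0, OF less_le_trans[OF _ len]] edge[of 1, OF less_le_trans[OF _ len]] len
    by (auto simp: numeral_2_eq_2)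
  moreover have "vs ! 0 \<noteq> vs ! 2"
    using d len by (subst nth_eq_iff_index_eq) auto
  ultimately have z: "z = vs ! 1" by auto
  have "z \<in> {vs ! 2, vs ! (3 mod length vs)}"
    using edge[of 2] len by (simp add: eval_nat_numeral)
  \<comment> \<open>The third edge ends at \<open>vs ! 0\<close> if the cycle is a triangle and at
    \<open>vs ! 3\<close> otherwise.\<close>
  moreover have "3 mod length vs \<noteq> 1" "3 mod length vs < length vs"
    using len by (cases "length vs = 3"; auto)+
  then have "vs ! 1 \<noteq> vs ! (3 mod length vs)"
    using d len by (subst nth_eq_iff_index_eq) auto
  moreover have "vs ! 1 \<noteq> vs ! 2"
    using d len by (subst nth_eq_iff_index_eq) auto
  ultimately show False using z by auto
qed

text \<open>The star at vertex 1 is independent, which forces \<open>3 + card B \<le> r\<close>. A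
  triangle joined with \<open>B\<close> is then small enough to be independent unless it lies in
  \<open>H\<close>; being dependent, it does.\<close>

lemma sparse_paving_MK4_minorE:
  assumes minor: "has_minor_iso (sparse_paving E r H) MK4" and E: "finite E"
    and H: "\<And>X. X \<in> H \<Longrightarrow> card X = r"
  obtains a b c a' b' c' B where "distinct [a, b, c, a', b', c']"
    "{a, b, c, a', b', c'} \<subseteq> E" "B \<subseteq> E" "B \<inter> {a, b, c, a', b', c'} = {}"
    "{a, b, c} \<union> B \<in> H" "{a, b', c'} \<union> B \<in> H" "{a', b, c'} \<union> B \<in> H" "{a', b', c} \<union> B \<in> H"
proof -
  have K4: "{{1, 2}, {1, 3}, {2, 3}, {3, 4}, {2, 4}, {1, 4}} \<subseteq> complete_graph {1..4::nat}"
    by (auto simp: complete_graph_def)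
  let ?S = "{{1, 2}, {1, 3}, {1, 4}} :: nat set set"
  have S: "?S \<in> indeps MK4" "?S \<subseteq> ground MK4"
    using K4 star_is_forest[of ?S 1] by (auto simp: MK4_def cycle_matroid_def)
  obtain g B where inj: "inj_on g (ground MK4)"
    and "g ` ground MK4 \<subseteq> ground (sparse_paving E r H)" "B \<subseteq> ground (sparse_paving E r H)"
    and disj: "B \<inter> g ` ground MK4 = {}"
    and star: "g ` ?S \<union> B \<in> indeps (sparse_paving E r H)"
    and dep: "\<And>F. F \<subseteq> ground MK4 \<Longrightarrow> F \<notin> indeps MK4 \<Longrightarrow>
                g ` F \<union> B \<notin> indeps (sparse_paving E r H)"
    using has_minor_isoE[OF minor S] by blast
  then have gE: "g ` ground MK4 \<subseteq> E" and B: "B \<subseteq> E" "B \<inter> g ` ground MK4 = {}"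
    by (simp_all add: sparse_paving_def)
  have G: "{{1, 2}, {1, 3}, {2, 3}, {3, 4}, {2, 4}, {1, 4}} \<subseteq> ground MK4"
    using K4 by (simp add: MK4_def cycle_matroid_def)
  have finB: "finite B" using B(1) E finite_subset by blast
  have card_B: "card (g ` F \<union> B) = card F + card B" if "F \<subseteq> ground MK4" "finite F" for F
    using that B(2) finB inj by (subst card_Un_disjoint) (auto simp: card_image inj_on_subset)
  have "card ?S = 3" by (simp add: doubleton_eq_iff)
  then have le: "3 + card B \<le> r"
    using star card_B[of ?S] G by (simp add: sparse_paving_def)
  have tri: "g ` {{u, v}, {v, w}, {w, u}} \<union> B \<in> H"
    if "distinct [u, v, w]" "{{u, v}, {v, w}, {w, u}} \<subseteq> ground MK4" for u v w
  proof -
    let ?T = "{{u, v}, {v, w}, {w, u}}"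
    have "card ?T = 3" using that(1) by (auto simp: doubleton_eq_iff card_insert_if)
    then have "card (g ` ?T \<union> B) \<le> r" using card_B[OF that(2)] le by simp
    moreover have "g ` ?T \<union> B \<subseteq> E" using that(2) gE B(1) by blast
    moreover have "?T \<notin> indeps MK4"
      using triangle_not_forest[OF that(1)] by (simp add: MK4_def cycle_matroid_def)
    ultimately show ?thesis
      using dep[OF that(2)] by (simp add: sparse_paving_def)
  qed
  \<comment> \<open>\<open>tri\<close> lists edges in cyclic order; these equations bring each edge
    into increasing form.\<close>
  have comm: "{2, 1} = {1, 2::nat}" "{3, 1} = {1, 3::nat}" "{4, 1} = {1, 4::nat}"
    "{3, 2} = {2, 3::nat}" "{4, 2} = {2, 4::nat}" "{4, 3} = {3, 4::nat}" by auto
  show thesis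
  proof
    \<comment> \<open>The order is a, b, c, a', b', c': a letter and its primed partner are opposite
      edges of K4.\<close>
    have "distinct [{1, 2}, {1, 3}, {2, 3}, {3, 4}, {2, 4}, {1, 4::nat}]"
      by (simp add: doubleton_eq_iff)
    then have "distinct (map g [{1, 2}, {1, 3}, {2, 3}, {3, 4}, {2, 4}, {1, 4}])"
      using inj_on_subset[OF inj G] by (subst distinct_map) simp
    then show "distinct [g {1, 2}, g {1, 3}, g {2, 3}, g {3, 4}, g {2, 4}, g {1, 4}]" by simp
    show "{g {1, 2}, g {1, 3}, g {2, 3}, g {3, 4}, g {2, 4}, g {1, 4}} \<subseteq> E"
      "B \<inter> {g {1, 2}, g {1, 3}, g {2, 3}, g {3, 4}, g {2, 4}, g {1, 4}} = {}"
      using G gE B(2) by auto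
    show "B \<subseteq> E" by (rule B(1))
    show "{g {1, 2}, g {1, 3}, g {2, 3}} \<union> B \<in> H"
      using tri[of 1 2 3] G by (simp add: comm insert_commute)
    show "{g {1, 2}, g {2, 4}, g {1, 4}} \<union> B \<in> H"
      using tri[of 1 2 4] G by (simp add: comm insert_commute)
    show "{g {3, 4}, g {1, 3}, g {1, 4}} \<union> B \<in> H"
      using tri[of 1 3 4] G by (simp add: comm insert_commute)
    show "{g {3, 4}, g {2, 4}, g {2, 3}} \<union> B \<in> H"
      using tri[of 2 3 4] G by (simp add: comm insert_commute)
  qed
qed

section \<open>Families of sets with prescribed element sum modulo \<open>q\<close>\<close>

definition residue_class :: "nat \<Rightarrow> nat \<Rightarrow> nat \<Rightarrow> nat \<Rightarrow> nat set set" where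
  "residue_class n r q k = {X. X \<subseteq> {1..n} \<and> card X = r \<and> \<Sum>X mod q = k}"

lemma cong_imp_eq_upto:
  assumes "[x = y] (mod q)" "x \<in> {1..n}" "y \<in> {1..n}" "n \<le> (q::nat)"
  shows "x = y"
proof -
  \<comment> \<open>The shift moves \<open>{1..n}\<close> below \<open>q\<close>, which matters when
    \<open>n = q\<close>.\<close>
  have "[x - 1 = y - 1] (mod q)"
    using assms cong_add_rcancel_nat[of "x - 1" 1 "y - 1" q] by simp
  then have "x - 1 = y - 1"
    using assms by (intro cong_less_modulus_unique_nat) auto
  then show ?thesis using assms by auto
qed

text \<open>A single exchange changes the sum by \<open>x - y\<close>, which is nonzero modulo
  \<open>q\<close> for distinct elements of \<open>{1..n}\<close>. In coding terms, the class has
  minimum distance at least 4.\<close>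

lemma is_matroid_sparse_paving_residue_class:
  assumes H: "H \<subseteq> residue_class n r q k" and "n \<le> q" "0 < r"
  shows "is_matroid (sparse_paving {1..n} r H)"
proof (rule is_matroid_sparse_paving)
  show "card X = r" if "X \<in> H" for X
    using that H by (auto simp: residue_class_def)
  show "x = y" if xy: "insert x I \<in> H" "insert y I \<in> H" "x \<notin> I" "y \<notin> I" for I x y
  proof (rule cong_imp_eq_upto[OF _ _ _ \<open>n \<le> q\<close>])
    have xyI: "insert x I \<in> residue_class n r q k" "insert y I \<in> residue_class n r q k"
      using xy H by auto
    then show "x \<in> {1..n}" "y \<in> {1..n}" by (auto simp: residue_class_def)
    have "finite (insert x I)"
      using xyI(1) finite_subset[of _ "{1..n}"] unfolding residue_class_def by blast
    then have "finite I" by simp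
    then have "[x + \<Sum>I = y + \<Sum>I] (mod q)"
      using xyI xy(3,4) by (simp add: residue_class_def cong_def)
    then show "[x = y] (mod q)" by (simp add: cong_add_rcancel_nat)
  qed
qed (use assms in auto)

lemma no_MK4_minor_sparse_paving_residue_class:
  assumes H: "H \<subseteq> residue_class n r q k" and "n \<le> q" "odd q"
  shows "\<not> has_minor_iso (sparse_paving {1..n} r H) MK4"
proof
  assume "has_minor_iso (sparse_paving {1..n} r H) MK4"
  then obtain a b c a' b' c' B where d: "distinct [a, b, c, a', b', c']"
    and E: "{a, b, c, a', b', c'} \<subseteq> {1..n}" "B \<subseteq> {1..n}"
    and disj: "B \<inter> {a, b, c, a', b', c'} = {}"
    and tri: "{a, b, c} \<union> B \<in> H" "{a, b', c'} \<union> B \<in> H"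
      "{a', b, c'} \<union> B \<in> H" "{a', b', c} \<union> B \<in> H"
    using H by (elim sparse_paving_MK4_minorE) (auto simp: residue_class_def)
  have fin: "finite B" using E(2) finite_subset by blast
  \<comment> \<open>The passage to integers avoids truncated subtraction when the four sums are
    combined.\<close>
  have sum_mod: "int q dvd int x + int y + int z + int (\<Sum>B) - int k"
    if "{x, y, z} \<union> B \<in> H" "distinct [x, y, z]" "B \<inter> {x, y, z} = {}" for x y z
  proof -
    have "\<Sum>({x, y, z} \<union> B) = x + y + z + \<Sum>B"
      using that(2,3) fin by (subst sum.union_disjoint) auto
    moreover have "\<Sum>({x, y, z} \<union> B) mod q = k"
      using that(1) H by (auto simp: residue_class_def)
    ultimately have "int (x + y + z + \<Sum>B) mod int q = int k"
      by (metis zmod_int)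
    then show ?thesis
      by (metis (no_types, lifting) dvd_minus_mod of_nat_add)
  qed
  define s where "s = int (\<Sum>B) - int k"
  have d': "distinct [a', b, c']" "distinct [a', b', c]" using d by auto
  have d1: "int q dvd int a + int b + int c + s"
    using sum_mod[OF tri(1)] d disj by (simp add: s_def add_diff_eq)
  have d2: "int q dvd int a + int b' + int c' + s"
    using sum_mod[OF tri(2)] d disj by (simp add: s_def add_diff_eq)
  have d3: "int q dvd int a' + int b + int c' + s"
    using sum_mod[OF tri(3) d'(1)] disj by (simp add: s_def add_diff_eq)
  have d4: "int q dvd int a' + int b' + int c + s"
    using sum_mod[OF tri(4) d'(2)] disj by (simp add: s_def add_diff_eq)
  \<comment> \<open>On either side b, b', c, c' occur once each and \<open>s\<close> twice, so only
    a and a' survive.\<close>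
  have "int q dvd ((int a + int b + int c + s) + (int a + int b' + int c' + s))
      - ((int a' + int b + int c' + s) + (int a' + int b' + int c + s))"
    by (intro dvd_diff dvd_add d1 d2 d3 d4)
  also have "\<dots> = 2 * (int a - int a')" by simp
  finally have "int q dvd 2 * (int a - int a')" .
  moreover have "coprime (int q) 2"
    using \<open>odd q\<close> by simp
  ultimately have "int q dvd int a - int a'"
    using coprime_dvd_mult_right_iff by blast
  then have "[a = a'] (mod q)"
    using cong_iff_dvd_diff cong_int_iff by blast
  then have "a = a'"
    using E(1) \<open>n \<le> q\<close> by (intro cong_imp_eq_upto) auto
  then show False using d by simp
qed

section \<open>Counting and the asymptotic bound\<close>

lemma exists_large_residue_class:
  assumes "0 < q"
  shows "\<exists>k. n choose r \<le> q * card (residue_class n r q k)"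
proof (rule ccontr)
  assume "\<nexists>k. n choose r \<le> q * card (residue_class n r q k)"
  then have small: "q * card (residue_class n r q k) < n choose r" for k
    by (simp add: not_le)
  have "{X. X \<subseteq> {1..n} \<and> card X = r} = (\<Union>k<q. residue_class n r q k)"
    using assms by (auto simp: residue_class_def)
  then have "n choose r = card (\<Union>k<q. residue_class n r q k)"
    using n_subsets[of "{1..n}" r] by simp
  also have "\<dots> \<le> (\<Sum>k<q. card (residue_class n r q k))"
    by (rule card_UN_le) simp
  finally have "q * (n choose r) \<le> (\<Sum>k<q. q * card (residue_class n r q k))"
    by (simp flip: sum_distrib_left)
  also have "\<dots> < (\<Sum>k<q. n choose r)"
    using small assms by (intro sum_strict_mono) auto
  finally show False by simp
qed

lemma two_power_residue_class_le_m':
  assumes "n \<le> q" "odd q" "0 < r"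
  shows "2 ^ card (residue_class n r q k) \<le> m' n"
proof -
  let ?R = "residue_class n r q k"
  have fin: "finite ?R"
    by (rule finite_subset[of _ "Pow {1..n}"]) (auto simp: residue_class_def)
  \<comment> \<open>An \<open>r\<close>-subset of the ground set is dependent exactly when it lies
    in \<open>H\<close>, so the matroid determines \<open>H\<close>.\<close>
  have recover: "H = {X. X \<subseteq> {1..n} \<and> card X = r} - indeps (sparse_paving {1..n} r H)"
    if "H \<subseteq> ?R" for H
    using that by (auto simp: sparse_paving_def residue_class_def)
  have "inj_on (sparse_paving {1..n} r) (Pow ?R)"
    by (intro inj_onI) (metis PowD recover)
  moreover have "sparse_paving {1..n} r ` Pow ?R \<subseteq> matroids_without_MK4 n"
    using is_matroid_sparse_paving_residue_class no_MK4_minor_sparse_paving_residue_class assms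
    by (auto simp: matroids_without_MK4_def) (simp add: sparse_paving_def)+
  ultimately have "card (Pow ?R) \<le> m' n"
    unfolding m'_def using finite_matroids_without_MK4 by (intro card_inj_on_le)
  then show ?thesis using fin by (simp add: card_Pow)
qed

lemma log_m'_ge:
  assumes "2 \<le> n"
  shows "real (n choose (n div 2)) / (real n + 1) \<le> log 2 (real (m' n))"
proof -
  \<comment> \<open>This is \<open>n\<close> for odd \<open>n\<close> and \<open>n + 1\<close> for
    even \<open>n\<close>; the bound \<open>q \<le> n + 1\<close> treats both parities
    alike.\<close>
  define q where "q = 2 * (n div 2) + 1"
  have q: "n \<le> q" "q \<le> n + 1" "odd q" "0 < q" unfolding q_def by auto
  obtain k where k: "n choose (n div 2) \<le> q * card (residue_class n (n div 2) q k)"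
    using exists_large_residue_class[OF q(4)] by blast
  let ?c = "card (residue_class n (n div 2) q k)"
  have "n choose (n div 2) \<le> (n + 1) * ?c"
    using k q(2) by (meson le_trans mult_le_mono1)
  then have "real (n choose (n div 2)) \<le> real ((n + 1) * ?c)"
    by (rule of_nat_mono)
  then have "real (n choose (n div 2)) / (real n + 1) \<le> real ?c"
    by (simp add: field_simps)
  also have "\<dots> = log 2 (real (2 ^ ?c))" by simp
  also have "\<dots> \<le> log 2 (real (m' n))"
  proof -
    have "2 ^ ?c \<le> m' n"
      \<comment> \<open>Here \<open>2 \<le> n\<close> makes the rank \<open>n div 2\<close>
        positive.\<close>
      using two_power_residue_class_le_m'[OF q(1,3)] assms by simp
    then have "real (2 ^ ?c) \<le> real (m' n)" by (rule of_nat_mono)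
    moreover have "0 < real (2 ^ ?c)" by simp
    ultimately show ?thesis by (subst log_le_cancel_iff) linarith+
  qed
  finally show ?thesis .
qed

theorem theorem1p3:
  shows "\<exists>\<epsilon> :: nat \<Rightarrow> real. \<epsilon> \<in> o(\<lambda>_. 1) \<and>
    (\<forall>\<^sub>F n in sequentially.
       log 2 (real (m' n)) \<ge> 1 / real n * real (n choose (n div 2)) * (1 - \<epsilon> n))"
proof (intro exI conjI)
  \<comment> \<open>With this error term \<open>1 - \<epsilon> n\<close> is
    \<open>n / (n + 1)\<close>, which turns the factor \<open>1 / n\<close> into exactly
    \<open>1 / (n + 1)\<close>.\<close>
  show "(\<lambda>n. 1 / (real n + 1)) \<in> o(\<lambda>_. 1)"
    using LIMSEQ_inverse_real_of_nat
    by (intro smalloI_tendsto) (simp_all add: inverse_eq_divide add.commute)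
  show "\<forall>\<^sub>F n in sequentially. log 2 (real (m' n))
      \<ge> 1 / real n * real (n choose (n div 2)) * (1 - 1 / (real n + 1))"
    using eventually_ge_at_top[of 2]
  proof eventually_elim
    case (elim n)
    then have "1 / real n * real (n choose (n div 2)) * (1 - 1 / (real n + 1))
        = real (n choose (n div 2)) / (real n + 1)"
      by (simp add: divide_simps)
    then show ?case using log_m'_ge[OF elim] by simp
  qed
qed

end
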